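(* Let $a,b,c$ be nonzero real constants and set $$H_1=u_{ty}-a u_{xy}-b u_{yy}+u_{xxxy}+c\,(u_{yyyy}-6v u_{yy})-3u_y u_{xx}-3u_x u_{xy},\qquad H_2=u_{yy}-v_x .$$ Smooth functions $\Lambda_1(x,y,t,u,v)$, $\Lambda_2(x,y,t,u,v)$ satisfy the determining equations for multipliers $$\frac{\delta}{\delta u}\big(\Lambda_1H_1+\Lambda_2H_2\big)=0,\qquad \frac{\delta}{\delta v}\big(\Lambda_1H_1+\Lambda_2H_2\big)=0$$ identically for arbitrary functions $u(x,y,t)$, $v(x,y,t)$ if and only if $$\Lambda_1=F_1(y,t),\qquad \Lambda_2=6c\,v\,F_1(y,t)+yF_2(t)+F_3(t)+\int\big(bF_{1y}-cF_{1yyy}-F_{1t}\big)\,dy$$ for some smooth functions $F_1=F_1(y,t)$, $F_2=F_2(t)$, $F_3=F_3(t)$.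
   Context: Here $\frac{\delta}{\delta u}$ and $\frac{\delta}{\delta v}$ are the Euler operators, $\frac{\delta}{\delta w}=\sum_{J}(-D)_J\frac{\partial}{\partial w_J}$ for $w=u,v$, where the sum runs over all multi-indices $J$ of derivatives in $x,y,t$ (including the empty one), $D_x,D_y,D_t$ are total derivatives, and $(-D)_J$ is the corresponding composition of $-D_x,-D_y,-D_t$. Subscripts on $F_1$ denote partial derivatives, e.g. $F_{1y}=\partial F_1/\partial y$, and $\int\cdot\,dy$ denotes any smooth antiderivative in $y$ (depending on $y,t$ only); the choice may be absorbed into $F_3(t)$. All functions are defined for all real values of their arguments. The system $H_1=0,\ H_2=0$ is the $(2+1)$-dimensional extended Boiti-Leon-Manna-Pempinelli system. *)

theory Defs
  imports "HOL-Analysis.Analysis" "HOL-Library.Groups_Big_Fun"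
begin

section \<open>Smooth functions\<close>

primrec times_cont_differentiable ::
  "nat \<Rightarrow> ('a::real_normed_vector \<Rightarrow> 'b::real_normed_vector) \<Rightarrow> bool" where
  "times_cont_differentiable 0 f \<longleftrightarrow> continuous_on UNIV f"
| "times_cont_differentiable (Suc k) f \<longleftrightarrow>
     (\<forall>z. f differentiable (at z)) \<and>
     (\<forall>h. times_cont_differentiable k (\<lambda>z. frechet_derivative f (at z) h))"

definition smooth :: "('a::real_normed_vector \<Rightarrow> 'b::real_normed_vector) \<Rightarrow> bool" where
  "smooth f \<longleftrightarrow> (\<forall>k. times_cont_differentiable k f)"

section \<open>Differential functions on the jet space\<close>

text \<open>
  The multi-index \<open>(i, j, k)\<close> stands for \<open>i\<close> derivatives in \<open>x\<close>, \<open>j\<close> in \<open>y\<close> and \<open>k\<close> in \<open>t\<close>.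
  A differential function takes the values of \<open>x\<close>, \<open>y\<close>, \<open>t\<close> and of all the jet coordinates
  \<open>u\<^sub>J\<close> and \<open>v\<^sub>J\<close>; in particular \<open>u (0, 0, 0)\<close> is the dependent variable \<open>u\<close> itself.
\<close>

type_synonym multi_index = "nat \<times> nat \<times> nat"

type_synonym jet = "multi_index \<Rightarrow> real"

type_synonym diff_fun = "real \<Rightarrow> real \<Rightarrow> real \<Rightarrow> jet \<Rightarrow> jet \<Rightarrow> real"

definition pd_u :: "multi_index \<Rightarrow> diff_fun \<Rightarrow> diff_fun" where
  "pd_u J F = (\<lambda>x y t u v. deriv (\<lambda>s. F x y t (u(J := s)) v) (u J))"

definition pd_v :: "multi_index \<Rightarrow> diff_fun \<Rightarrow> diff_fun" where
  "pd_v J F = (\<lambda>x y t u v. deriv (\<lambda>s. F x y t u (v(J := s))) (v J))"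

text \<open>
  \<open>Sum_any\<close> sums over the indices with a nonzero summand. There are finitely many of them below
  whenever the differential function depends on finitely many jet coordinates; otherwise
  the value 0 of \<open>Sum_any\<close> is meaningless.
\<close>

definition jet_part :: "(multi_index \<Rightarrow> multi_index) \<Rightarrow> diff_fun \<Rightarrow> diff_fun" where
  "jet_part S F = (\<lambda>x y t u v.
     Sum_any (\<lambda>J. u (S J) * pd_u J F x y t u v) +
     Sum_any (\<lambda>J. v (S J) * pd_v J F x y t u v))"

definition Dx :: "diff_fun \<Rightarrow> diff_fun" where
  "Dx F = (\<lambda>x y t u v.
     deriv (\<lambda>s. F s y t u v) x + jet_part (\<lambda>(i, j, k). (Suc i, j, k)) F x y t u v)"

definition Dy :: "diff_fun \<Rightarrow> diff_fun" where
  "Dy F = (\<lambda>x y t u v.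
     deriv (\<lambda>s. F x s t u v) y + jet_part (\<lambda>(i, j, k). (i, Suc j, k)) F x y t u v)"

definition Dt :: "diff_fun \<Rightarrow> diff_fun" where
  "Dt F = (\<lambda>x y t u v.
     deriv (\<lambda>s. F x y s u v) t + jet_part (\<lambda>(i, j, k). (i, j, Suc k)) F x y t u v)"

definition minus_D :: "multi_index \<Rightarrow> diff_fun \<Rightarrow> diff_fun" where
  "minus_D = (\<lambda>(i, j, k) F.
     ((\<lambda>G x y t u v. - Dx G x y t u v) ^^ i)
       (((\<lambda>G x y t u v. - Dy G x y t u v) ^^ j)
         (((\<lambda>G x y t u v. - Dt G x y t u v) ^^ k) F)))"

definition euler_u :: "diff_fun \<Rightarrow> diff_fun" where
  "euler_u F = (\<lambda>x y t u v. Sum_any (\<lambda>J. minus_D J (pd_u J F) x y t u v))"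

definition euler_v :: "diff_fun \<Rightarrow> diff_fun" where
  "euler_v F = (\<lambda>x y t u v. Sum_any (\<lambda>J. minus_D J (pd_v J F) x y t u v))"

definition jet_of :: "(real \<Rightarrow> real \<Rightarrow> real \<Rightarrow> real) \<Rightarrow> real \<Rightarrow> real \<Rightarrow> real \<Rightarrow> jet" where
  "jet_of f x y t = (\<lambda>(i, j, k).
     (deriv ^^ i) (\<lambda>x'. (deriv ^^ j) (\<lambda>y'. (deriv ^^ k) (\<lambda>t'. f x' y' t') t) y) x)"

definition vanishes_identically :: "diff_fun \<Rightarrow> bool" where
  "vanishes_identically F \<longleftrightarrow>
     (\<forall>f g. smooth (\<lambda>(x, y, t). f x y t) \<longrightarrow> smooth (\<lambda>(x, y, t). g x y t) \<longrightarrow>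
       (\<forall>x y t. F x y t (jet_of f x y t) (jet_of g x y t) = 0))"

section \<open>The extended Boiti-Leon-Manna-Pempinelli system\<close>

definition H1 :: "real \<Rightarrow> real \<Rightarrow> real \<Rightarrow> diff_fun" where
  "H1 a b c = (\<lambda>x y t u v.
     u (0, 1, 1) - a * u (1, 1, 0) - b * u (0, 2, 0) + u (3, 1, 0)
     + c * (u (0, 4, 0) - 6 * v (0, 0, 0) * u (0, 2, 0))
     - 3 * u (0, 1, 0) * u (2, 0, 0) - 3 * u (1, 0, 0) * u (1, 1, 0))"

definition H2 :: diff_fun where
  "H2 = (\<lambda>x y t u v. u (0, 2, 0) - v (1, 0, 0))"

definition multiplier_combination ::
  "real \<Rightarrow> real \<Rightarrow> real \<Rightarrow> (real \<Rightarrow> real \<Rightarrow> real \<Rightarrow> real \<Rightarrow> real \<Rightarrow> real) \<Rightarrow>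
   (real \<Rightarrow> real \<Rightarrow> real \<Rightarrow> real \<Rightarrow> real \<Rightarrow> real) \<Rightarrow> diff_fun" where
  "multiplier_combination a b c \<Lambda>1 \<Lambda>2 = (\<lambda>x y t u v.
     \<Lambda>1 x y t (u (0, 0, 0)) (v (0, 0, 0)) * H1 a b c x y t u v +
     \<Lambda>2 x y t (u (0, 0, 0)) (v (0, 0, 0)) * H2 x y t u v)"

definition y_antiderivative :: "(real \<Rightarrow> real \<Rightarrow> real) \<Rightarrow> (real \<Rightarrow> real \<Rightarrow> real) \<Rightarrow> bool" where
  "y_antiderivative f G \<longleftrightarrow>
     smooth (\<lambda>(y, t). G y t) \<and>
     (\<forall>y t. ((\<lambda>s. G s t) has_real_derivative f y t) (at y))"

end

(* The combination contains v only through v and v_x, so the v-equation is explicit: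
     Lambda1_v H1 + (Lambda2_v - 6 c Lambda1) u_yy + Lambda2_x + u_x Lambda2_u = 0.
   Test functions u = u0 + alpha (x - x0) + beta (y - y0)^2 + gamma (y - y0)^4 with v constant make
   u_x, u_yy and u_yyyy independent at a given point, which separates the coefficients and forces
   Lambda1 = F(y, t) and Lambda2 = 6 c v F + g(y, t). For such multipliers all jet coordinates cancel
   from the u-equation, leaving F_ty + g_yy - b F_yy + c F_yyyy = 0. Hence g_y differs from
   b F_y - c F_yyy - F_t by a function F2(t), and G = g - y F2 is the antiderivative, with F3 = 0. *)
theory Submission
  imports Defs
begin

section \<open>Calculus of smooth maps: closure properties and partial derivatives\<close>

section \<open>Smooth functions\<close>

text \<open>Needed for the product rule, which pairs an undifferentiated factor with a
  differentiated one, so that both must be brought to the same order.\<close>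

lemma times_cont_differentiable_Suc_D:
  "times_cont_differentiable (Suc k) f \<Longrightarrow> times_cont_differentiable k f"
proof (induction k arbitrary: f)
  case 0
  then show ?case
    by (simp add: continuous_at_imp_continuous_on differentiable_imp_continuous_within)
next
  case (Suc k)
  then show ?case by (metis times_cont_differentiable.simps(2))
qed

text \<open>Uniqueness of the derivative identifies any explicit candidate \<open>f'\<close> with
  \<open>frechet_derivative\<close>, the operator on which the recursive definition rests.\<close>

lemma times_cont_differentiable_SucI:
  assumes "\<And>z. (f has_derivative f' z) (at z)" "\<And>h. times_cont_differentiable k (\<lambda>z. f' z h)"
  shows "times_cont_differentiable (Suc k) f"
proof -
  have "frechet_derivative f (at z) = f' z" for z
    using assms(1) frechet_derivative_at by metis
  then show ?thesis
    using assms by (auto simp: differentiable_def)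
qed

lemma times_cont_differentiable_Suc_has_derivative:
  "times_cont_differentiable (Suc k) f \<Longrightarrow> (f has_derivative frechet_derivative f (at z)) (at z)"
  using frechet_derivative_works by auto

lemma times_cont_differentiable_const: "times_cont_differentiable k (\<lambda>z. c)"
  by (induction k arbitrary: c)
    (auto intro!: times_cont_differentiable_SucI derivative_eq_intros simp del: times_cont_differentiable.simps(2))

lemma times_cont_differentiable_bounded_linear:
  assumes "bounded_linear f"
  shows "times_cont_differentiable k f"
proof (cases k)
  case 0
  then show ?thesis using assms by (simp add: linear_continuous_on)
next
  case (Suc n)
  then show ?thesis
    using times_cont_differentiable_SucI[of f "\<lambda>_. f" n] bounded_linear_imp_has_derivative[OF assms]
      times_cont_differentiable_const by blast
qed

lemma times_cont_differentiable_add: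
  "times_cont_differentiable k f \<Longrightarrow> times_cont_differentiable k g \<Longrightarrow>
    times_cont_differentiable k (\<lambda>z. f z + g z)"
proof (induction k arbitrary: f g)
  case 0
  then show ?case by (simp add: continuous_on_add)
next
  case (Suc k)
  show ?case
  proof (rule times_cont_differentiable_SucI)
    show "((\<lambda>z. f z + g z) has_derivative
        (\<lambda>h. frechet_derivative f (at z) h + frechet_derivative g (at z) h)) (at z)" for z
      by (intro has_derivative_add Suc.prems[THEN times_cont_differentiable_Suc_has_derivative])
    show "times_cont_differentiable k
        (\<lambda>z. frechet_derivative f (at z) h + frechet_derivative g (at z) h)" for h
      using Suc by simp
  qed
qed

lemma times_cont_differentiable_mult:
  fixes f g :: "'a::real_normed_vector \<Rightarrow> real"
  shows "times_cont_differentiable k f \<Longrightarrow> times_cont_differentiable k g \<Longrightarrow>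
    times_cont_differentiable k (\<lambda>z. f z * g z)"
proof (induction k arbitrary: f g)
  case 0
  then show ?case by (simp add: continuous_on_mult)
next
  case (Suc k)
  show ?case
  proof (rule times_cont_differentiable_SucI)
    show "((\<lambda>z. f z * g z) has_derivative
        (\<lambda>h. f z * frechet_derivative g (at z) h + frechet_derivative f (at z) h * g z)) (at z)" for z
      by (intro has_derivative_mult Suc.prems[THEN times_cont_differentiable_Suc_has_derivative])
    show "times_cont_differentiable k
        (\<lambda>z. f z * frechet_derivative g (at z) h + frechet_derivative f (at z) h * g z)" for h
      by (intro times_cont_differentiable_add Suc.IH)
        (use Suc.prems times_cont_differentiable_Suc_D in auto)
  qed
qed

text \<open>For a linear inner map the chain rule gives the derivative of \<open>f\<close> at
  \<open>l z\<close> in the direction \<open>l h\<close>. This direction does not depend on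
  \<open>z\<close>, so the induction hypothesis applies to the derivative directly.\<close>

lemma times_cont_differentiable_compose_bounded_linear:
  assumes "bounded_linear l"
  shows "times_cont_differentiable k f \<Longrightarrow> times_cont_differentiable k (\<lambda>z. f (l z))"
proof (induction k arbitrary: f)
  case 0
  then show ?case
    using continuous_on_compose2[OF _ linear_continuous_on[OF assms], of UNIV f UNIV] by simp
next
  case (Suc k)
  show ?case
  proof (rule times_cont_differentiable_SucI)
    show "((\<lambda>z. f (l z)) has_derivative (\<lambda>h. frechet_derivative f (at (l z)) (l h))) (at z)" for z
      by (intro has_derivative_compose[OF bounded_linear_imp_has_derivative[OF assms]]
        times_cont_differentiable_Suc_has_derivative[OF Suc.prems])
    show "times_cont_differentiable k (\<lambda>z. frechet_derivative f (at (l z)) (l h))" for h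
      by (rule Suc.IH) (use Suc.prems in simp)
  qed
qed

lemma smooth_const: "smooth (\<lambda>z. c)"
  by (simp add: smooth_def times_cont_differentiable_const)

lemma smooth_bounded_linear: "bounded_linear f \<Longrightarrow> smooth f"
  by (simp add: smooth_def times_cont_differentiable_bounded_linear)

lemma smooth_add: "smooth f \<Longrightarrow> smooth g \<Longrightarrow> smooth (\<lambda>z. f z + g z)"
  by (simp add: smooth_def times_cont_differentiable_add)

lemma smooth_mult:
  fixes f g :: "'a::real_normed_vector \<Rightarrow> real"
  shows "smooth f \<Longrightarrow> smooth g \<Longrightarrow> smooth (\<lambda>z. f z * g z)"
  by (simp add: smooth_def times_cont_differentiable_mult)

lemma smooth_diff:
  fixes f g :: "'a::real_normed_vector \<Rightarrow> real"
  assumes "smooth f" "smooth g"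
  shows "smooth (\<lambda>z. f z - g z)"
  using smooth_add[OF assms(1) smooth_mult[OF smooth_const[of "-1"] assms(2)]] by simp

lemma smooth_power:
  fixes f :: "'a::real_normed_vector \<Rightarrow> real"
  shows "smooth f \<Longrightarrow> smooth (\<lambda>z. f z ^ n)"
  by (induction n) (simp_all add: smooth_const smooth_mult)

lemma smooth_compose_bounded_linear: "smooth f \<Longrightarrow> bounded_linear l \<Longrightarrow> smooth (\<lambda>z. f (l z))"
  by (simp add: smooth_def times_cont_differentiable_compose_bounded_linear)

lemma smooth_frechet_derivative: "smooth f \<Longrightarrow> smooth (\<lambda>z. frechet_derivative f (at z) h)"
  by (metis smooth_def times_cont_differentiable.simps(2))

lemma smooth_has_derivative: "smooth f \<Longrightarrow> (f has_derivative frechet_derivative f (at z)) (at z)"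
  using smooth_def times_cont_differentiable_Suc_has_derivative by blast

text \<open>Chain rule along a curve. Letting \<open>p\<close> run along a coordinate axis turns
  partial derivatives into Frechet derivatives in the direction of a basis vector.\<close>

lemma smooth_has_real_derivative_along:
  fixes f :: "'a::real_normed_vector \<Rightarrow> real"
  assumes "smooth f" and "(p has_vector_derivative h) (at s)"
  shows "((\<lambda>s. f (p s)) has_real_derivative frechet_derivative f (at (p s)) h) (at s)"
proof -
  have D: "(f has_derivative frechet_derivative f (at (p s))) (at (p s))"
    by (rule smooth_has_derivative[OF assms(1)])
  have "((\<lambda>s. f (p s)) has_derivative (\<lambda>r. frechet_derivative f (at (p s)) (r *\<^sub>R h))) (at s)"
    using has_derivative_compose[OF assms(2)[unfolded has_vector_derivative_def] D] .
  moreover have "(\<lambda>r. frechet_derivative f (at (p s)) (r *\<^sub>R h)) = (*) (frechet_derivative f (at (p s)) h)"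
    using linear_scale[OF has_derivative_linear[OF D]] by (auto simp: fun_eq_iff mult.commute)
  ultimately show ?thesis by (simp add: has_field_derivative_def)
qed

text \<open>The partial derivatives are the directional derivatives along \<open>(1, 0)\<close> and
  \<open>(0, 1)\<close>, and these are smooth by the definition of smoothness.\<close>

lemma
  fixes f :: "real \<Rightarrow> real \<Rightarrow> real"
  assumes "smooth (\<lambda>(y, t). f y t)"
  shows smooth_partial_y: "smooth (\<lambda>(y, t). deriv (\<lambda>s. f s t) y)"
    and smooth_partial_t: "smooth (\<lambda>(y, t). deriv (\<lambda>s. f y s) t)"
    and smooth_DERIV_y: "((\<lambda>s. f s t) has_real_derivative deriv (\<lambda>s. f s t) y) (at y)"
proof -
  let ?f = "\<lambda>(y, t). f y t"
  have y: "((\<lambda>s. f s t) has_real_derivative frechet_derivative ?f (at (y, t)) (1, 0)) (at y)" for y t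
  proof -
    have "((\<lambda>s. (s, t)) has_vector_derivative (1, 0)) (at y)"
      unfolding has_vector_derivative_def by (auto intro!: derivative_eq_intros simp: zero_prod_def)
    from smooth_has_real_derivative_along[OF assms this] show ?thesis by simp
  qed
  have t: "((\<lambda>s. f y s) has_real_derivative frechet_derivative ?f (at (y, t)) (0, 1)) (at t)" for y t
  proof -
    have "((\<lambda>s. (y, s)) has_vector_derivative (0, 1)) (at t)"
      unfolding has_vector_derivative_def by (auto intro!: derivative_eq_intros simp: zero_prod_def)
    from smooth_has_real_derivative_along[OF assms this] show ?thesis by simp
  qed
  show "((\<lambda>s. f s t) has_real_derivative deriv (\<lambda>s. f s t) y) (at y)"
    using y DERIV_imp_deriv by metis
  have "(\<lambda>(y, t). deriv (\<lambda>s. f s t) y) = (\<lambda>z. frechet_derivative ?f (at z) (1, 0))"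
    using DERIV_imp_deriv[OF y] by (auto simp: fun_eq_iff)
  then show "smooth (\<lambda>(y, t). deriv (\<lambda>s. f s t) y)"
    using smooth_frechet_derivative[OF assms] by simp
  have "(\<lambda>(y, t). deriv (\<lambda>s. f y s) t) = (\<lambda>z. frechet_derivative ?f (at z) (0, 1))"
    using DERIV_imp_deriv[OF t] by (auto simp: fun_eq_iff)
  then show "smooth (\<lambda>(y, t). deriv (\<lambda>s. f y s) t)"
    using smooth_frechet_derivative[OF assms] by simp
qed

text \<open>These are the arguments in which the v-equation differentiates the multipliers.
  Derivatives in \<open>y\<close> and \<open>t\<close> enter only after the reduction to functions
  of \<open>y\<close> and \<open>t\<close>.\<close>

lemma
  fixes f :: "real \<Rightarrow> real \<Rightarrow> real \<Rightarrow> real \<Rightarrow> real \<Rightarrow> real"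
  assumes "smooth (\<lambda>(x, y, t, u, v). f x y t u v)"
  shows smooth_DERIV_arg1: "((\<lambda>s. f s y t u v) has_real_derivative deriv (\<lambda>s. f s y t u v) x) (at x)"
    and smooth_DERIV_arg4: "((\<lambda>s. f x y t s v) has_real_derivative deriv (\<lambda>s. f x y t s v) u) (at u)"
    and smooth_DERIV_arg5: "((\<lambda>s. f x y t u s) has_real_derivative deriv (\<lambda>s. f x y t u s) v) (at v)"
proof -
  have x: "((\<lambda>s. f s y t u v) has_real_derivative
      frechet_derivative (\<lambda>(x, y, t, u, v). f x y t u v) (at (x, y, t, u, v)) (1, 0, 0, 0, 0)) (at x)"
  proof -
    have "((\<lambda>s. (s, y, t, u, v)) has_vector_derivative (1, 0, 0, 0, 0)) (at x)"
      unfolding has_vector_derivative_def by (auto intro!: derivative_eq_intros simp: zero_prod_def)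
    from smooth_has_real_derivative_along[OF assms this] show ?thesis by simp
  qed
  then show "((\<lambda>s. f s y t u v) has_real_derivative deriv (\<lambda>s. f s y t u v) x) (at x)"
    using DERIV_imp_deriv by metis
  have "((\<lambda>s. f x y t s v) has_real_derivative
      frechet_derivative (\<lambda>(x, y, t, u, v). f x y t u v) (at (x, y, t, u, v)) (0, 0, 0, 1, 0)) (at u)"
  proof -
    have "((\<lambda>s. (x, y, t, s, v)) has_vector_derivative (0, 0, 0, 1, 0)) (at u)"
      unfolding has_vector_derivative_def by (auto intro!: derivative_eq_intros simp: zero_prod_def)
    from smooth_has_real_derivative_along[OF assms this] show ?thesis by simp
  qed
  then show "((\<lambda>s. f x y t s v) has_real_derivative deriv (\<lambda>s. f x y t s v) u) (at u)"
    using DERIV_imp_deriv by metis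
  have "((\<lambda>s. f x y t u s) has_real_derivative
      frechet_derivative (\<lambda>(x, y, t, u, v). f x y t u v) (at (x, y, t, u, v)) (0, 0, 0, 0, 1)) (at v)"
  proof -
    have "((\<lambda>s. (x, y, t, u, s)) has_vector_derivative (0, 0, 0, 0, 1)) (at v)"
      unfolding has_vector_derivative_def by (auto intro!: derivative_eq_intros simp: zero_prod_def)
    from smooth_has_real_derivative_along[OF assms this] show ?thesis by simp
  qed
  then show "((\<lambda>s. f x y t u s) has_real_derivative deriv (\<lambda>s. f x y t u s) v) (at v)"
    using DERIV_imp_deriv by metis
qed

section \<open>Reduction of total derivatives and Euler operators to finite sums\<close>

section \<open>Total derivatives and Euler operators\<close>

text \<open>Any finite superset of the support serves as \<open>A\<close>, so exact supports never
  have to be found. Finiteness excludes the default value 0 of \<open>Sum_any\<close>.\<close>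

lemma Sum_any_eq_sum:
  assumes "finite A" "\<And>J. J \<notin> A \<Longrightarrow> f J = 0"
  shows "Sum_any f = sum f A"
  by (rule Sum_any.expand_superset) (use assms in auto)

lemma jet_part_of_support:
  assumes "finite A" "\<And>J. J \<notin> A \<Longrightarrow> pd_u J F x y t u v = 0"
    and "finite B" "\<And>J. J \<notin> B \<Longrightarrow> pd_v J F x y t u v = 0"
  shows "jet_part S F x y t u v =
    (\<Sum>J\<in>A. u (S J) * pd_u J F x y t u v) + (\<Sum>J\<in>B. v (S J) * pd_v J F x y t u v)"
  unfolding jet_part_def using assms by (subst (1 2) Sum_any_eq_sum) auto

text \<open>This shape covers the u-equation: for the reduced multipliers, each function to be
  differentiated there is affine in at most two u-coordinates, with coefficients in \<open>y\<close>
  and \<open>t\<close>.\<close>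

lemma jet_part_linear_u:
  assumes "K \<noteq> K'"
  shows "jet_part S (\<lambda>x y t u v. A y t + u K * B y t + u K' * B' y t) x y t u v =
    u (S K) * B y t + u (S K') * B' y t"
proof -
  let ?F = "\<lambda>x y t (u :: jet) (v :: jet). A y t + u K * B y t + u K' * B' y t"
  have u: "pd_u J ?F x y t u v = (if J = K then B y t else if J = K' then B' y t else 0)" for J
    unfolding pd_u_def using assms
    by (intro DERIV_imp_deriv) (auto intro!: derivative_eq_intros)
  have v: "pd_v J ?F x y t u v = 0" for J
    unfolding pd_v_def by simp
  show ?thesis
    using assms by (subst jet_part_of_support[where A="{K, K'}" and B="{}"]) (simp_all add: u v)
qed

lemma Dx_linear_u:
  assumes "(i, j, k) \<noteq> (i', j', k')"
  shows "Dx (\<lambda>x y t u v. A y t + u (i, j, k) * B y t + u (i', j', k') * B' y t) =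
    (\<lambda>x y t u v. u (Suc i, j, k) * B y t + u (Suc i', j', k') * B' y t)"
  unfolding Dx_def jet_part_linear_u[OF assms] by simp

lemma Dx_linear_u1:
  "Dx (\<lambda>x y t u v. A y t + u (i, j, k) * B y t) = (\<lambda>x y t u v. u (Suc i, j, k) * B y t)"
  \<comment> \<open>The second coordinate has coefficient zero; its index only has to differ from
    \<open>(i, j, k)\<close>.\<close>
  using Dx_linear_u[of i j k "Suc i" j k A B "\<lambda>_ _. 0"] by simp

lemma Dx_base: "Dx (\<lambda>x y t u v. A y t) = (\<lambda>x y t u v. 0)"
  using Dx_linear_u1[of A 0 0 0 "\<lambda>_ _. 0"] by simp

lemma Dt_base: "Dt (\<lambda>x y t u v. A y t) = (\<lambda>x y t u v. deriv (\<lambda>s. A y s) t)"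
  unfolding Dt_def
  using jet_part_linear_u[of "(0, 0, 0)" "(1, 0, 0)" _ A "\<lambda>_ _. 0" "\<lambda>_ _. 0"] by simp

text \<open>In contrast to \<open>Dx\<close>, the explicit derivative now acts on the coefficients;
  their smoothness justifies splitting \<open>deriv\<close> over the sum.\<close>

lemma Dy_linear_u1:
  assumes "smooth (\<lambda>(y, t). A y t)" "smooth (\<lambda>(y, t). B y t)"
  shows "Dy (\<lambda>x y t u v. A y t + u (i, j, k) * B y t) =
    (\<lambda>x y t u v. deriv (\<lambda>s. A s t) y + u (i, j, k) * deriv (\<lambda>s. B s t) y + u (i, Suc j, k) * B y t)"
proof -
  have "deriv (\<lambda>s. A s t + u (i, j, k) * B s t) y =
      deriv (\<lambda>s. A s t) y + u (i, j, k) * deriv (\<lambda>s. B s t) y" for y t and u :: jet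
    by (rule DERIV_imp_deriv)
      (auto intro!: derivative_eq_intros smooth_DERIV_y[OF assms(1)] smooth_DERIV_y[OF assms(2)])
  then show ?thesis
    unfolding Dy_def
    using jet_part_linear_u[of "(i, j, k)" "(Suc i, j, k)" _ A B "\<lambda>_ _. 0"]
    by simp
qed

lemma Dy_base: "Dy (\<lambda>x y t u v. A y t) = (\<lambda>x y t u v. deriv (\<lambda>s. A s t) y)"
  unfolding Dy_def
  using jet_part_linear_u[of "(0, 0, 0)" "(1, 0, 0)" _ A "\<lambda>_ _. 0" "\<lambda>_ _. 0"] by simp

text \<open>Only the index \<open>(0, 0, 0)\<close> contributes to the jet part, and there
  \<open>pd_u\<close> and \<open>pd_v\<close> are the partial derivatives of \<open>f\<close> in its
  fourth and fifth arguments.\<close>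

lemma Dx_order_zero:
  "Dx (\<lambda>x y t u v. f x y t (u (0, 0, 0)) (v (0, 0, 0))) = (\<lambda>x y t u v.
    deriv (\<lambda>s. f s y t (u (0, 0, 0)) (v (0, 0, 0))) x +
    u (1, 0, 0) * deriv (\<lambda>s. f x y t s (v (0, 0, 0))) (u (0, 0, 0)) +
    v (1, 0, 0) * deriv (\<lambda>s. f x y t (u (0, 0, 0)) s) (v (0, 0, 0)))"
proof -
  let ?F = "\<lambda>x y t (u :: jet) (v :: jet). f x y t (u (0, 0, 0)) (v (0, 0, 0))"
  have u: "pd_u J ?F x y t u v =
      (if J = (0, 0, 0) then deriv (\<lambda>s. f x y t s (v (0, 0, 0))) (u (0, 0, 0)) else 0)" for J x y t u v
    unfolding pd_u_def by simp
  have v: "pd_v J ?F x y t u v =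
      (if J = (0, 0, 0) then deriv (\<lambda>s. f x y t (u (0, 0, 0)) s) (v (0, 0, 0)) else 0)" for J x y t u v
    unfolding pd_v_def by simp
  have "jet_part S ?F x y t u v =
      u (S (0, 0, 0)) * deriv (\<lambda>s. f x y t s (v (0, 0, 0))) (u (0, 0, 0)) +
      v (S (0, 0, 0)) * deriv (\<lambda>s. f x y t (u (0, 0, 0)) s) (v (0, 0, 0))" for S x y t u v
    by (subst jet_part_of_support[where A="{(0, 0, 0)}" and B="{(0, 0, 0)}"]) (simp_all add: u v)
  then show ?thesis
    unfolding Dx_def by (simp add: fun_eq_iff)
qed

lemma minus_D_zero: "minus_D J (\<lambda>x y t u v. 0) = (\<lambda>x y t u v. 0)"
proof -
  have "Dx (\<lambda>x y t u v. 0) = (\<lambda>x y t u v. 0)" "Dy (\<lambda>x y t u v. 0) = (\<lambda>x y t u v. 0)"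
    "Dt (\<lambda>x y t u v. 0) = (\<lambda>x y t u v. 0)"
    using Dx_base[of "\<lambda>_ _. 0"] Dy_base[of "\<lambda>_ _. 0"] Dt_base[of "\<lambda>_ _. 0"] by simp_all
  then have "((\<lambda>G x y t u v. - Dx G x y t u v) ^^ n) (\<lambda>x y t u v. 0) = (\<lambda>x y t u v. 0)"
    "((\<lambda>G x y t u v. - Dy G x y t u v) ^^ n) (\<lambda>x y t u v. 0) = (\<lambda>x y t u v. 0)"
    "((\<lambda>G x y t u v. - Dt G x y t u v) ^^ n) (\<lambda>x y t u v. 0) = (\<lambda>x y t u v. 0)" for n
    by (induction n) simp_all
  then show ?thesis
    by (simp add: minus_D_def split: prod.split)
qed

text \<open>Outside \<open>A\<close> the partial derivative has to vanish as a function and not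
  merely at one point, because \<open>minus_D\<close> differentiates it.\<close>

lemma euler_u_of_support:
  assumes "finite A" "\<And>J. J \<notin> A \<Longrightarrow> pd_u J F = (\<lambda>x y t u v. 0)"
  shows "euler_u F x y t u v = (\<Sum>J\<in>A. minus_D J (pd_u J F) x y t u v)"
  unfolding euler_u_def by (rule Sum_any_eq_sum) (simp_all add: assms minus_D_zero)

lemma euler_v_of_support:
  assumes "finite A" "\<And>J. J \<notin> A \<Longrightarrow> pd_v J F = (\<lambda>x y t u v. 0)"
  shows "euler_v F x y t u v = (\<Sum>J\<in>A. minus_D J (pd_v J F) x y t u v)"
  unfolding euler_v_def by (rule Sum_any_eq_sum) (simp_all add: assms minus_D_zero)

lemma vanishes_identicallyD:
  assumes "vanishes_identically F" "smooth (\<lambda>(x, y, t). f x y t)" "smooth (\<lambda>(x, y, t). g x y t)"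
  shows "F x y t (jet_of f x y t) (jet_of g x y t) = 0"
  using assms by (simp add: vanishes_identically_def)

section \<open>Explicit form of both determining equations, and their solution\<close>

section \<open>The determining equations\<close>

text \<open>The index \<open>(1, 0, 0)\<close> contributes \<open>Dx\<close> of
  \<open>\<Lambda>2\<close>. Its \<open>v (1, 0, 0)\<close> term cancels the one that
  \<open>H2\<close> brings in at the index \<open>(0, 0, 0)\<close>.\<close>

lemma euler_v_multiplier_combination:
  assumes "smooth (\<lambda>(x, y, t, u, v). \<Lambda>1 x y t u v)" "smooth (\<lambda>(x, y, t, u, v). \<Lambda>2 x y t u v)"
  shows "euler_v (multiplier_combination a b c \<Lambda>1 \<Lambda>2) x y t u v =
    deriv (\<lambda>s. \<Lambda>1 x y t (u (0, 0, 0)) s) (v (0, 0, 0)) * H1 a b c x y t u v +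
    deriv (\<lambda>s. \<Lambda>2 x y t (u (0, 0, 0)) s) (v (0, 0, 0)) * u (0, 2, 0) -
    6 * c * \<Lambda>1 x y t (u (0, 0, 0)) (v (0, 0, 0)) * u (0, 2, 0) +
    deriv (\<lambda>s. \<Lambda>2 s y t (u (0, 0, 0)) (v (0, 0, 0))) x +
    u (1, 0, 0) * deriv (\<lambda>s. \<Lambda>2 x y t s (v (0, 0, 0))) (u (0, 0, 0))"
proof -
  let ?L = "multiplier_combination a b c \<Lambda>1 \<Lambda>2"
  have 0: "pd_v (0, 0, 0) ?L = (\<lambda>x y t u v.
    deriv (\<lambda>s. \<Lambda>1 x y t (u (0, 0, 0)) s) (v (0, 0, 0)) * H1 a b c x y t u v +
    deriv (\<lambda>s. \<Lambda>2 x y t (u (0, 0, 0)) s) (v (0, 0, 0)) * H2 x y t u v -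
    6 * c * \<Lambda>1 x y t (u (0, 0, 0)) (v (0, 0, 0)) * u (0, 2, 0))"
    unfolding pd_v_def multiplier_combination_def H1_def H2_def
    by (intro ext DERIV_imp_deriv)
      (auto intro!: derivative_eq_intros smooth_DERIV_arg5[OF assms(1)] smooth_DERIV_arg5[OF assms(2)]
        simp: algebra_simps)
  have 1: "pd_v (1, 0, 0) ?L = (\<lambda>x y t u v. - \<Lambda>2 x y t (u (0, 0, 0)) (v (0, 0, 0)))"
    unfolding pd_v_def multiplier_combination_def H1_def H2_def
    by (intro ext DERIV_imp_deriv) (auto intro!: derivative_eq_intros)
  have other: "pd_v J ?L = (\<lambda>x y t u v. 0)" if J: "J \<notin> {(0, 0, 0), (1, 0, 0)}" for J
  proof -
    have "K \<noteq> J" if "K \<in> {(0, 0, 0), (1, 0, 0)}" for K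
      using that J by blast
    then show ?thesis
      unfolding pd_v_def multiplier_combination_def H1_def H2_def by simp
  qed
  have neg: "deriv (\<lambda>s. - f s) z = - deriv f z" if "(f has_real_derivative deriv f z) (at z)" for f z
    using that by (intro DERIV_imp_deriv) (rule DERIV_minus)
  have "euler_v ?L x y t u v = (\<Sum>J\<in>{(0, 0, 0), (1, 0, 0)}. minus_D J (pd_v J ?L) x y t u v)"
    by (rule euler_v_of_support[OF _ other]) simp_all
  then show ?thesis
    by (simp add: minus_D_def 0 1[simplified] H2_def algebra_simps
        Dx_order_zero[of "\<lambda>x y t u v. - \<Lambda>2 x y t u v"]
        neg[OF smooth_DERIV_arg1[OF assms(2)]] neg[OF smooth_DERIV_arg4[OF assms(2)]]
        neg[OF smooth_DERIV_arg5[OF assms(2)]])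
qed

text \<open>The terms of \<open>H1\<close> and \<open>H2\<close> linear in \<open>u\<close> produce
  the right-hand side by repeated integration by parts in \<open>y\<close> and \<open>t\<close>; any
  total derivative in \<open>x\<close> kills a coefficient depending on \<open>y\<close> and
  \<open>t\<close> alone. The contributions of the quadratic terms cancel each other.\<close>

lemma euler_u_multiplier_combination:
  assumes F: "smooth (\<lambda>(y, t). F y t)" and g: "smooth (\<lambda>(y, t). g y t)"
  shows "euler_u (multiplier_combination a b c (\<lambda>x y t u v. F y t) (\<lambda>x y t u v. 6 * c * v * F y t + g y t))
      x y t u v =
    deriv (\<lambda>s. deriv (\<lambda>r. F s r) t) y + (deriv ^^ 2) (\<lambda>s. g s t) y - b * (deriv ^^ 2) (\<lambda>s. F s t) y +
    c * (deriv ^^ 4) (\<lambda>s. F s t) y"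
proof -
  let ?L = "multiplier_combination a b c (\<lambda>x y t u v. F y t) (\<lambda>x y t u v. 6 * c * v * F y t + g y t)"
  let ?A = "{(0, 1, 1), (1, 1, 0), (0, 2, 0), (3, 1, 0), (0, 4, 0), (0, 1, 0), (2, 0, 0), (1, 0, 0)}"
  note L_def = pd_u_def multiplier_combination_def H1_def H2_def
  \<comment> \<open>At \<open>(0, 2, 0)\<close> the coordinate \<open>v\<close> drops out: the
    summand \<open>6 c v F\<close> of the second multiplier cancels the term
    \<open>- 6 c v F\<close> coming from \<open>H1\<close>.\<close>
  have pd: "pd_u (0, 1, 1) ?L = (\<lambda>x y t u v. F y t)"
    "pd_u (1, 1, 0) ?L = (\<lambda>x y t u v. - a * F y t + u (1, 0, 0) * (- 3 * F y t))"
    "pd_u (0, 2, 0) ?L = (\<lambda>x y t u v. g y t - b * F y t)"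
    "pd_u (3, 1, 0) ?L = (\<lambda>x y t u v. F y t)"
    "pd_u (0, 4, 0) ?L = (\<lambda>x y t u v. c * F y t)"
    "pd_u (0, 1, 0) ?L = (\<lambda>x y t u v. u (2, 0, 0) * (- 3 * F y t))"
    "pd_u (2, 0, 0) ?L = (\<lambda>x y t u v. u (0, 1, 0) * (- 3 * F y t))"
    "pd_u (1, 0, 0) ?L = (\<lambda>x y t u v. u (1, 1, 0) * (- 3 * F y t))"
    unfolding L_def
    by (intro ext DERIV_imp_deriv; auto intro!: derivative_eq_intros simp: algebra_simps)+
  have other: "pd_u J ?L = (\<lambda>x y t u v. 0)" if J: "J \<notin> ?A" for J
  proof -
    have "K \<noteq> J" if "K \<in> ?A" for K
      using that J by blast
    then show ?thesis
      unfolding L_def by simp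
  qed
  note Fy = smooth_partial_y[OF F] and gy = smooth_partial_y[OF g]
  note Fyy = smooth_partial_y[OF Fy] note Fyyy = smooth_partial_y[OF Fyy]
  have cF: "smooth (\<lambda>(y, t). k * F y t)" for k
    using smooth_mult[OF smooth_const F, of k] by (simp add: case_prod_beta')
  have deriv_cmult: "deriv (\<lambda>s. k * f s t) y = k * deriv (\<lambda>s. f s t) y"
    if "smooth (\<lambda>(y, t). f y t)" for f :: "real \<Rightarrow> real \<Rightarrow> real" and k y t
    by (intro DERIV_imp_deriv DERIV_cmult smooth_DERIV_y that)
  have deriv_neg: "deriv (\<lambda>s. - f s t) y = - deriv (\<lambda>s. f s t) y"
    if "smooth (\<lambda>(y, t). f y t)" for f :: "real \<Rightarrow> real \<Rightarrow> real" and y t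
    by (intro DERIV_imp_deriv DERIV_minus smooth_DERIV_y that)
  have deriv_sub: "deriv (\<lambda>s. f s t - k * h s t) y = deriv (\<lambda>s. f s t) y - k * deriv (\<lambda>s. h s t) y"
    if "smooth (\<lambda>(y, t). f y t)" "smooth (\<lambda>(y, t). h y t)" for f h :: "real \<Rightarrow> real \<Rightarrow> real" and k y t
    by (intro DERIV_imp_deriv DERIV_diff DERIV_cmult smooth_DERIV_y that)
  \<comment> \<open>The sign in \<open>- Dy\<close> reverses the difference, so its second
    application meets the terms in the opposite order.\<close>
  have deriv_sub': "deriv (\<lambda>s. k * h s t - f s t) y = k * deriv (\<lambda>s. h s t) y - deriv (\<lambda>s. f s t) y"
    if "smooth (\<lambda>(y, t). f y t)" "smooth (\<lambda>(y, t). h y t)" for f h :: "real \<Rightarrow> real \<Rightarrow> real" and k y t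
    by (intro DERIV_imp_deriv DERIV_diff DERIV_cmult smooth_DERIV_y that)
  have deriv_neg_cmult: "deriv (\<lambda>s. - (k * f s t)) y = - (k * deriv (\<lambda>s. f s t) y)"
    if "smooth (\<lambda>(y, t). f y t)" for f :: "real \<Rightarrow> real \<Rightarrow> real" and k y t
    by (intro DERIV_imp_deriv DERIV_minus DERIV_cmult smooth_DERIV_y that)
  note D = minus_D_def eval_nat_numeral
  have m1: "minus_D (0, 1, 1) (\<lambda>x y t u v. F y t) x y t u v = deriv (\<lambda>s. deriv (\<lambda>r. F s r) t) y"
    by (simp add: D Dt_base Dy_base deriv_neg[OF smooth_partial_t[OF F]])
  have m2: "minus_D (0, 2, 0) (\<lambda>x y t u v. g y t - b * F y t) x y t u v =
      (deriv ^^ 2) (\<lambda>s. g s t) y - b * (deriv ^^ 2) (\<lambda>s. F s t) y"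
    by (simp add: D Dy_base deriv_sub[OF g F] deriv_sub'[OF gy Fy])
  have m3: "minus_D (3, 1, 0) (\<lambda>x y t u v. F y t) x y t u v = 0"
    by (simp add: D Dy_base Dx_base)
  have m4: "minus_D (0, 4, 0) (\<lambda>x y t u v. c * F y t) x y t u v = c * (deriv ^^ 4) (\<lambda>s. F s t) y"
    by (simp add: D Dy_base deriv_cmult[OF F] deriv_neg_cmult[OF Fy] deriv_cmult[OF Fyy]
        deriv_neg_cmult[OF Fyyy])
  have Dx_neg: "Dx (\<lambda>x y t u v. - (u (i, j, k) * (l * F y t))) = (\<lambda>x y t u v. - (u (Suc i, j, k) * (l * F y t)))"
    and Dx_pos: "Dx (\<lambda>x y t u v. u (i, j, k) * (l * F y t)) = (\<lambda>x y t u v. u (Suc i, j, k) * (l * F y t))"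
    for i j k l
    using Dx_linear_u1[of "\<lambda>_ _. 0" i j k "\<lambda>y t. - (l * F y t)"]
      Dx_linear_u1[of "\<lambda>_ _. 0" i j k "\<lambda>y t. l * F y t"] by simp_all
  have Dy: "Dy (\<lambda>x y t u v. l' * F y t + u (i, j, k) * (l * F y t)) = (\<lambda>x y t u v.
      l' * deriv (\<lambda>s. F s t) y + u (i, j, k) * (l * deriv (\<lambda>s. F s t) y) + u (i, Suc j, k) * (l * F y t))"
    for i j k l l'
    using Dy_linear_u1[OF cF cF, of l' i j k l] by (simp add: deriv_cmult[OF F])
  have minus_D: "minus_D (0, 1, 0) E = (\<lambda>x y t u v. - Dy E x y t u v)"
    "minus_D (1, 0, 0) E = (\<lambda>x y t u v. - Dx E x y t u v)"
    "minus_D (2, 0, 0) E = (\<lambda>x y t u v. - Dx (\<lambda>x y t u v. - Dx E x y t u v) x y t u v)"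
    "minus_D (1, 1, 0) E = (\<lambda>x y t u v. - Dx (\<lambda>x y t u v. - Dy E x y t u v) x y t u v)" for E
    by (simp_all add: D)
  \<comment> \<open>The quantities \<open>m5\<close> to \<open>m8\<close> carry the quadratic terms
    and sum to zero. The linear term with \<open>a\<close> sits in \<open>m8\<close> and is removed
    by \<open>Dx\<close>.\<close>
  have m5: "minus_D (0, 1, 0) (\<lambda>x y t u v. u (2, 0, 0) * (- 3 * F y t)) x y t u v =
      3 * u (2, 1, 0) * F y t + 3 * u (2, 0, 0) * deriv (\<lambda>s. F s t) y"
    unfolding minus_D using Dy[of 0 2 0 0 "- 3"] by simp
  have m6: "minus_D (2, 0, 0) (\<lambda>x y t u v. u (0, 1, 0) * (- 3 * F y t)) x y t u v =
      - 3 * u (2, 1, 0) * F y t"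
    unfolding minus_D Dx_pos Dx_neg by (simp add: numeral_eq_Suc)
  have m7: "minus_D (1, 0, 0) (\<lambda>x y t u v. u (1, 1, 0) * (- 3 * F y t)) x y t u v =
      3 * u (2, 1, 0) * F y t"
    unfolding minus_D Dx_pos by (simp add: numeral_eq_Suc)
  have "Dx (\<lambda>x y t u v. - (- a * deriv (\<lambda>s. F s t) y + u (1, 0, 0) * (- 3 * deriv (\<lambda>s. F s t) y) +
      u (1, Suc 0, 0) * (- 3 * F y t))) =
    (\<lambda>x y t u v. u (2, 0, 0) * (3 * deriv (\<lambda>s. F s t) y) + u (2, 1, 0) * (3 * F y t))"
    using Dx_linear_u[of 1 0 0 1 1 0 "\<lambda>y t. a * deriv (\<lambda>s. F s t) y" "\<lambda>y t. 3 * deriv (\<lambda>s. F s t) y"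
        "\<lambda>y t. 3 * F y t"]
    by (simp add: numeral_2_eq_2 algebra_simps)
  then have m8: "minus_D (1, 1, 0) (\<lambda>x y t u v. - a * F y t + u (1, 0, 0) * (- 3 * F y t)) x y t u v =
      - 3 * u (2, 0, 0) * deriv (\<lambda>s. F s t) y - 3 * u (2, 1, 0) * F y t"
    unfolding minus_D Dy by simp
  have "euler_u ?L x y t u v = (\<Sum>J\<in>?A. minus_D J (pd_u J ?L) x y t u v)"
    by (rule euler_u_of_support[OF _ other]) simp_all
  then show ?thesis
    by (simp add: pd[simplified] m1[simplified] m2[simplified] m3[simplified] m4[simplified]
        m5[simplified] m6[simplified] m7[simplified] m8[simplified])
qed

section \<open>Polynomial test functions with prescribed jet coordinates at a point\<close>

lemma smooth_polynomial_test_function: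
  "smooth (\<lambda>(x', y', t'). u0 + \<alpha> * (x' - x) + \<beta> * (y' - y) ^ 2 + \<gamma> * (y' - y) ^ 4 :: real)"
  unfolding case_prod_beta'
  by (intro smooth_add smooth_mult smooth_diff smooth_power smooth_const
      smooth_bounded_linear[OF bounded_linear_fst]
      smooth_bounded_linear[OF bounded_linear_compose[OF bounded_linear_fst bounded_linear_snd]])

text \<open>Centring the powers at the evaluation point leaves at most one parameter in each
  coordinate. The indices listed are those at which the v-equation, including \<open>H1\<close>,
  evaluates a jet.\<close>

lemma jet_of_polynomial_test_function:
  fixes u0 \<alpha> \<beta> \<gamma> x y :: real
  defines "f \<equiv> \<lambda>x' y' t'. u0 + \<alpha> * (x' - x) + \<beta> * (y' - y) ^ 2 + \<gamma> * (y' - y) ^ 4 :: real"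
  shows "jet_of f x y t (0, 0, 0) = u0" "jet_of f x y t (1, 0, 0) = \<alpha>"
    "jet_of f x y t (2, 0, 0) = 0" "jet_of f x y t (0, 1, 0) = 0"
    "jet_of f x y t (0, 2, 0) = 2 * \<beta>" "jet_of f x y t (0, 4, 0) = 24 * \<gamma>"
    "jet_of f x y t (1, 1, 0) = 0" "jet_of f x y t (3, 1, 0) = 0" "jet_of f x y t (0, 1, 1) = 0"
proof -
  \<comment> \<open>Here \<open>k\<close> stands for the part depending on \<open>x\<close>, which
    is constant under differentiation in \<open>y\<close>.\<close>
  have 1: "deriv (\<lambda>z. k + \<beta> * (z - y) ^ 2 + \<gamma> * (z - y) ^ 4) =
      (\<lambda>z. 2 * \<beta> * (z - y) + 4 * \<gamma> * (z - y) ^ 3)" for k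
    by (intro ext DERIV_imp_deriv) (auto intro!: derivative_eq_intros)
  have 2: "deriv (\<lambda>z. 2 * \<beta> * (z - y) + 4 * \<gamma> * (z - y) ^ 3) = (\<lambda>z. 2 * \<beta> + 12 * \<gamma> * (z - y) ^ 2)"
    by (intro ext DERIV_imp_deriv) (auto intro!: derivative_eq_intros)
  have 3: "deriv (\<lambda>z. 2 * \<beta> + 12 * \<gamma> * (z - y) ^ 2) = (\<lambda>z. 24 * \<gamma> * (z - y))"
    by (intro ext DERIV_imp_deriv) (auto intro!: derivative_eq_intros)
  have 4: "deriv (\<lambda>z. 24 * \<gamma> * (z - y)) = (\<lambda>z. 24 * \<gamma>)"
    by (intro ext DERIV_imp_deriv) (auto intro!: derivative_eq_intros)
  have x: "deriv (\<lambda>z. u0 + \<alpha> * (z - x)) = (\<lambda>z. \<alpha>)"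
    by (intro ext DERIV_imp_deriv) (auto intro!: derivative_eq_intros)
  have num: "(deriv ^^ 2) h = deriv (deriv h)" "(deriv ^^ 3) h = deriv (deriv (deriv h))"
    "(deriv ^^ 4) h = deriv (deriv (deriv (deriv h)))" for h :: "real \<Rightarrow> real"
    by (simp_all add: numeral_eq_Suc)
  have const: "deriv (\<lambda>z. k) = (\<lambda>z. 0)" for k :: real
    by (simp add: fun_eq_iff)
  show "jet_of f x y t (0, 0, 0) = u0" "jet_of f x y t (1, 0, 0) = \<alpha>"
    "jet_of f x y t (2, 0, 0) = 0" "jet_of f x y t (0, 1, 0) = 0"
    "jet_of f x y t (0, 2, 0) = 2 * \<beta>" "jet_of f x y t (0, 4, 0) = 24 * \<gamma>"
    "jet_of f x y t (1, 1, 0) = 0" "jet_of f x y t (3, 1, 0) = 0" "jet_of f x y t (0, 1, 1) = 0"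
    by (simp_all add: jet_of_def f_def num 1 2 3 4 x const)
qed

text \<open>On the test functions the v-equation is affine in the free parameters
  \<open>\<alpha>\<close>, \<open>\<beta>\<close>, \<open>\<gamma>\<close>, so each coefficient
  vanishes. The one of \<open>\<gamma>\<close> is \<open>24 c\<close> times the v-derivative of
  \<open>\<Lambda>1\<close>, which is where \<open>c \<noteq> 0\<close> enters.\<close>

lemma euler_v_determining_equations:
  assumes "c \<noteq> 0"
    and L1: "smooth (\<lambda>(x, y, t, u, v). \<Lambda>1 x y t u v)" and L2: "smooth (\<lambda>(x, y, t, u, v). \<Lambda>2 x y t u v)"
    and van: "vanishes_identically (euler_v (multiplier_combination a b c \<Lambda>1 \<Lambda>2))"
  shows "deriv (\<lambda>s. \<Lambda>1 x y t u s) v = 0" "deriv (\<lambda>s. \<Lambda>2 x y t u s) v = 6 * c * \<Lambda>1 x y t u v"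
    "deriv (\<lambda>s. \<Lambda>2 s y t u v) x = 0" "deriv (\<lambda>s. \<Lambda>2 x y t s v) u = 0"
proof -
  have eq: "deriv (\<lambda>s. \<Lambda>1 x y t u s) v * (c * (24 * \<gamma> - 12 * v * \<beta>) - 2 * b * \<beta>) +
      deriv (\<lambda>s. \<Lambda>2 x y t u s) v * (2 * \<beta>) - 6 * c * \<Lambda>1 x y t u v * (2 * \<beta>) +
      deriv (\<lambda>s. \<Lambda>2 s y t u v) x + \<alpha> * deriv (\<lambda>s. \<Lambda>2 x y t s v) u = 0" for \<alpha> \<beta> \<gamma>
  proof -
    let ?f = "\<lambda>x' y' t'. u + \<alpha> * (x' - x) + \<beta> * (y' - y) ^ 2 + \<gamma> * (y' - y) ^ 4"
    \<comment> \<open>Zero coefficients write the constant \<open>v\<close> in the form of a test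
      function.\<close>
    let ?g = "\<lambda>x' y' t'. v + 0 * (x' - x) + 0 * (y' - y) ^ 2 + 0 * (y' - y) ^ 4"
    have "euler_v (multiplier_combination a b c \<Lambda>1 \<Lambda>2) x y t (jet_of ?f x y t) (jet_of ?g x y t) = 0"
      by (rule vanishes_identicallyD[OF van smooth_polynomial_test_function
            smooth_polynomial_test_function])
    then show ?thesis
      unfolding euler_v_multiplier_combination[OF L1 L2] H1_def jet_of_polynomial_test_function
      by (simp add: algebra_simps)
  qed
  \<comment> \<open>The positional arguments of \<open>eq\<close> follow first occurrence in its
    statement: \<open>\<gamma>\<close>, then \<open>\<beta>\<close>, then
    \<open>\<alpha>\<close>.\<close>
  show x: "deriv (\<lambda>s. \<Lambda>2 s y t u v) x = 0"
    using eq[of 0 0 0] by simp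
  show u: "deriv (\<lambda>s. \<Lambda>2 x y t s v) u = 0"
    using eq[of 0 0 1] x by simp
  show v: "deriv (\<lambda>s. \<Lambda>1 x y t u s) v = 0"
    using eq[of 1 0 0] x \<open>c \<noteq> 0\<close> by simp
  show "deriv (\<lambda>s. \<Lambda>2 x y t u s) v = 6 * c * \<Lambda>1 x y t u v"
    using eq[of 0 1 0] x v by simp
qed

text \<open>Integrates the four equations, with base point 0 in each of \<open>x\<close>,
  \<open>u\<close> and \<open>v\<close>.\<close>

lemma euler_v_solution:
  assumes "c \<noteq> 0"
    and L1: "smooth (\<lambda>(x, y, t, u, v). \<Lambda>1 x y t u v)" and L2: "smooth (\<lambda>(x, y, t, u, v). \<Lambda>2 x y t u v)"
    and van: "vanishes_identically (euler_v (multiplier_combination a b c \<Lambda>1 \<Lambda>2))"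
  shows "\<Lambda>1 x y t u v = \<Lambda>1 0 y t 0 0" "\<Lambda>2 x y t u v = 6 * c * v * \<Lambda>1 0 y t 0 0 + \<Lambda>2 0 y t 0 0"
proof -
  note eqs = euler_v_determining_equations[OF assms]
  have 1: "\<Lambda>1 x y t u v = \<Lambda>1 x y t u 0" for x y t u v
    using DERIV_isconst_all smooth_DERIV_arg5[OF L1] eqs(1) by metis
  have 2: "\<Lambda>2 x y t u v = \<Lambda>2 0 y t 0 v" for x y t u v
  proof -
    have "\<Lambda>2 x y t u v = \<Lambda>2 0 y t u v"
      using DERIV_isconst_all[of "\<lambda>s. \<Lambda>2 s y t u v"] smooth_DERIV_arg1[OF L2] eqs(3) by metis
    also have "\<dots> = \<Lambda>2 0 y t 0 v"
      using DERIV_isconst_all[of "\<lambda>s. \<Lambda>2 0 y t s v"] smooth_DERIV_arg4[OF L2] eqs(4) by metis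
    finally show ?thesis .
  qed
  \<comment> \<open>No equation constrains \<open>\<Lambda>1\<close> in \<open>x\<close> or
    \<open>u\<close> directly. But \<open>\<Lambda>2\<close> is free of both, hence so is its
    v-derivative \<open>6 c \<Lambda>1\<close>, and \<open>c \<noteq> 0\<close> allows
    division.\<close>
  have 3: "\<Lambda>1 x y t u v = \<Lambda>1 0 y t 0 0" for x y t u v
  proof -
    have "(\<lambda>s. \<Lambda>2 x y t u s) = (\<lambda>s. \<Lambda>2 0 y t 0 s)"
      using 2[of x y t u] by (rule ext)
    then have "6 * c * \<Lambda>1 x y t u v = 6 * c * \<Lambda>1 0 y t 0 v"
      unfolding eqs(2)[symmetric] by (rule arg_cong)
    then show ?thesis
      using \<open>c \<noteq> 0\<close> 1[of 0 y t 0 v] by simp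
  qed
  then show "\<Lambda>1 x y t u v = \<Lambda>1 0 y t 0 0" .
  have "((\<lambda>s. \<Lambda>2 0 y t 0 s - 6 * c * s * \<Lambda>1 0 y t 0 0) has_real_derivative 0) (at s)" for s
    using 3[of 0 y t 0 s] eqs(2)[of 0 y t 0 s]
    by (auto intro!: derivative_eq_intros smooth_DERIV_arg5[OF L2])
  then have "\<Lambda>2 0 y t 0 v - 6 * c * v * \<Lambda>1 0 y t 0 0 = \<Lambda>2 0 y t 0 0 - 6 * c * 0 * \<Lambda>1 0 y t 0 0"
    by (intro DERIV_isconst_all) blast
  then show "\<Lambda>2 x y t u v = 6 * c * v * \<Lambda>1 0 y t 0 0 + \<Lambda>2 0 y t 0 0"
    using 2[of x y t u v] by simp
qed

text \<open>With this \<open>h\<close> the u-equation reads \<open>g_yy = h_y\<close>, the form used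
  in both directions of the equivalence.\<close>

lemma smooth_and_deriv_y_integrand:
  fixes F :: "real \<Rightarrow> real \<Rightarrow> real" and b c :: real
  assumes F: "smooth (\<lambda>(y, t). F y t)"
  defines "h \<equiv> \<lambda>y t. b * deriv (\<lambda>s. F s t) y - c * (deriv ^^ 3) (\<lambda>s. F s t) y - deriv (\<lambda>s. F y s) t"
  shows "smooth (\<lambda>(y, t). h y t)"
    and "deriv (\<lambda>s. h s t) y = b * (deriv ^^ 2) (\<lambda>s. F s t) y - c * (deriv ^^ 4) (\<lambda>s. F s t) y -
      deriv (\<lambda>s. deriv (\<lambda>r. F s r) t) y"
proof -
  note Fy = smooth_partial_y[OF F]
  note Fyyy = smooth_partial_y[OF smooth_partial_y[OF Fy]]
  have h: "h = (\<lambda>y t. b * deriv (\<lambda>s. F s t) y - c * deriv (deriv (deriv (\<lambda>s. F s t))) y -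
      deriv (\<lambda>s. F y s) t)"
    by (simp add: h_def numeral_eq_Suc)
  show "smooth (\<lambda>(y, t). h y t)"
    using smooth_diff[OF smooth_diff[OF smooth_mult[OF smooth_const[of b] Fy]
        smooth_mult[OF smooth_const[of c] Fyyy]] smooth_partial_t[OF F]]
    by (simp add: h case_prod_beta')
  show "deriv (\<lambda>s. h s t) y = b * (deriv ^^ 2) (\<lambda>s. F s t) y - c * (deriv ^^ 4) (\<lambda>s. F s t) y -
      deriv (\<lambda>s. deriv (\<lambda>r. F s r) t) y"
    unfolding h
    by (intro DERIV_imp_deriv)
      (auto intro!: derivative_eq_intros smooth_DERIV_y[OF Fy] smooth_DERIV_y[OF Fyyy]
        smooth_DERIV_y[OF smooth_partial_t[OF F]] simp: numeral_eq_Suc)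
qed

theorem mainTheorem3:
  fixes a b c :: real
    and \<Lambda>1 \<Lambda>2 :: "real \<Rightarrow> real \<Rightarrow> real \<Rightarrow> real \<Rightarrow> real \<Rightarrow> real"
  assumes "a \<noteq> 0" and "b \<noteq> 0" and "c \<noteq> 0"
    and "smooth (\<lambda>(x, y, t, u, v). \<Lambda>1 x y t u v)"
    and "smooth (\<lambda>(x, y, t, u, v). \<Lambda>2 x y t u v)"
  shows "vanishes_identically (euler_u (multiplier_combination a b c \<Lambda>1 \<Lambda>2)) \<and>
         vanishes_identically (euler_v (multiplier_combination a b c \<Lambda>1 \<Lambda>2))
     \<longleftrightarrow>
     (\<exists>(F1 :: real \<Rightarrow> real \<Rightarrow> real) (F2 :: real \<Rightarrow> real) (F3 :: real \<Rightarrow> real)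
        (G :: real \<Rightarrow> real \<Rightarrow> real).
        smooth (\<lambda>(y, t). F1 y t) \<and> smooth F2 \<and> smooth F3 \<and>
        y_antiderivative
          (\<lambda>y t. b * deriv (\<lambda>s. F1 s t) y - c * (deriv ^^ 3) (\<lambda>s. F1 s t) y
                  - deriv (\<lambda>s. F1 y s) t) G \<and>
        (\<forall>x y t u v. \<Lambda>1 x y t u v = F1 y t) \<and>
        (\<forall>x y t u v. \<Lambda>2 x y t u v = 6 * c * v * F1 y t + y * F2 t + F3 t + G y t))"
proof (intro iffI; (elim exE conjE)?)
  assume u: "vanishes_identically (euler_u (multiplier_combination a b c \<Lambda>1 \<Lambda>2))"
    and v: "vanishes_identically (euler_v (multiplier_combination a b c \<Lambda>1 \<Lambda>2))"
  define F where "F = (\<lambda>y t. \<Lambda>1 0 y t 0 0)"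
  define g where "g = (\<lambda>y t. \<Lambda>2 0 y t 0 0)"
  have Lambda: "\<Lambda>1 = (\<lambda>x y t u v. F y t)" "\<Lambda>2 = (\<lambda>x y t u v. 6 * c * v * F y t + g y t)"
    unfolding F_def g_def by (intro ext euler_v_solution[OF assms(3-5) v])+
  \<comment> \<open>The linear embedding of the slice \<open>x = u = v = 0\<close>; composing with
    it makes \<open>F\<close> and \<open>g\<close> smooth.\<close>
  have emb: "bounded_linear (\<lambda>z :: real \<times> real. (0 :: real, fst z, snd z, 0 :: real, 0 :: real))"
    by (intro bounded_linear_Pair bounded_linear_zero bounded_linear_fst bounded_linear_snd)
  have F: "smooth (\<lambda>(y, t). F y t)" and g: "smooth (\<lambda>(y, t). g y t)"
    using smooth_compose_bounded_linear[OF assms(4) emb] smooth_compose_bounded_linear[OF assms(5) emb]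
    by (simp_all add: F_def g_def case_prod_beta')
  define h where "h = (\<lambda>y t. b * deriv (\<lambda>s. F s t) y - c * (deriv ^^ 3) (\<lambda>s. F s t) y
    - deriv (\<lambda>s. F y s) t)"
  have h: "smooth (\<lambda>(y, t). h y t)"
    unfolding h_def by (rule smooth_and_deriv_y_integrand[OF F])
  note gy = smooth_partial_y[OF g]
  have gyy: "deriv (\<lambda>s. deriv (\<lambda>s. g s t) s) y = deriv (\<lambda>s. h s t) y" for y t
  proof -
    \<comment> \<open>The u-equation for these multipliers contains no jet coordinates, so the zero
      functions already extract all its content.\<close>
    have "smooth (\<lambda>(x :: real, y :: real, t :: real). 0 :: real)"
      using smooth_const by (simp add: case_prod_beta')
    then have "euler_u (multiplier_combination a b c \<Lambda>1 \<Lambda>2) 0 y t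
        (jet_of (\<lambda>_ _ _. 0) 0 y t) (jet_of (\<lambda>_ _ _. 0) 0 y t) = 0"
      by (intro vanishes_identicallyD[OF u])
    then show ?thesis
      unfolding Lambda euler_u_multiplier_combination[OF F g] h_def smooth_and_deriv_y_integrand(2)[OF F]
      by (simp add: numeral_eq_Suc)
  qed
  \<comment> \<open>The defect \<open>g_y - h\<close> has zero y-derivative by \<open>gyy\<close>;
    its value at \<open>y = 0\<close> becomes \<open>F2\<close>.\<close>
  define k where "k = (\<lambda>y t. deriv (\<lambda>s. g s t) y - h y t)"
  have k: "smooth (\<lambda>(y, t). k y t)"
    using smooth_diff[OF gy h] by (simp add: k_def case_prod_beta')
  have "((\<lambda>s. k s t) has_real_derivative 0) (at y)" for y t
    unfolding k_def
    by (auto intro!: derivative_eq_intros smooth_DERIV_y[OF gy] smooth_DERIV_y[OF h] simp: gyy)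
  then have k0: "k y t = k 0 t" for y t
    by (intro DERIV_isconst_all[of "\<lambda>s. k s t"] allI)
  have F2: "smooth (\<lambda>t. k 0 t)"
    using smooth_compose_bounded_linear[OF k bounded_linear_Pair[OF bounded_linear_zero bounded_linear_ident]]
    by simp
  define G where "G = (\<lambda>y t. g y t - y * k 0 t)"
  have "smooth (\<lambda>(y, t). G y t)"
    using smooth_diff[OF g smooth_mult[OF smooth_bounded_linear[OF bounded_linear_fst]
        smooth_compose_bounded_linear[OF F2 bounded_linear_snd]]]
    by (simp add: G_def case_prod_beta')
  \<comment> \<open>By \<open>k0\<close> the subtracted \<open>k 0 t\<close> equals
    \<open>k y t\<close>, so the derivative \<open>g_y - k\<close> is \<open>h\<close>.\<close>
  moreover have "((\<lambda>s. G s t) has_real_derivative h y t) (at y)" for y t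
    unfolding G_def using k0[of y t]
    by (auto intro!: derivative_eq_intros smooth_DERIV_y[OF g] simp: k_def)
  ultimately have "y_antiderivative h G"
    by (simp add: y_antiderivative_def)
  then show "\<exists>F1 F2 F3 G. smooth (\<lambda>(y, t). F1 y t) \<and> smooth F2 \<and> smooth F3 \<and>
      y_antiderivative (\<lambda>y t. b * deriv (\<lambda>s. F1 s t) y - c * (deriv ^^ 3) (\<lambda>s. F1 s t) y
        - deriv (\<lambda>s. F1 y s) t) G \<and>
      (\<forall>x y t u v. \<Lambda>1 x y t u v = F1 y t) \<and>
      (\<forall>x y t u v. \<Lambda>2 x y t u v = 6 * c * v * F1 y t + y * F2 t + F3 t + G y t)"
    unfolding h_def using F F2 smooth_const[of 0]
    by (intro exI[of _ F] exI[of _ "\<lambda>t. k 0 t"] exI[of _ "\<lambda>t. 0"] exI[of _ G])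
      (simp add: Lambda G_def)
next
  fix F1 G :: "real \<Rightarrow> real \<Rightarrow> real" and F2 F3 :: "real \<Rightarrow> real"
  define h where "h = (\<lambda>y t. b * deriv (\<lambda>s. F1 s t) y - c * (deriv ^^ 3) (\<lambda>s. F1 s t) y
    - deriv (\<lambda>s. F1 y s) t)"
  \<comment> \<open>Collecting the v-free part of \<open>\<Lambda>2\<close> brings the converse
    under the same formula for the u-equation.\<close>
  define g where "g = (\<lambda>y t. y * F2 t + F3 t + G y t)"
  assume F: "smooth (\<lambda>(y, t). F1 y t)" and F2: "smooth F2" and F3: "smooth F3"
    and "y_antiderivative (\<lambda>y t. b * deriv (\<lambda>s. F1 s t) y - c * (deriv ^^ 3) (\<lambda>s. F1 s t) y
        - deriv (\<lambda>s. F1 y s) t) G"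
    and "\<forall>x y t u v. \<Lambda>1 x y t u v = F1 y t"
    and "\<forall>x y t u v. \<Lambda>2 x y t u v = 6 * c * v * F1 y t + y * F2 t + F3 t + G y t"
  then have G: "smooth (\<lambda>(y, t). G y t)" "\<And>y t. ((\<lambda>s. G s t) has_real_derivative h y t) (at y)"
    and Lambda: "\<Lambda>1 = (\<lambda>x y t u v. F1 y t)" "\<Lambda>2 = (\<lambda>x y t u v. 6 * c * v * F1 y t + g y t)"
    unfolding y_antiderivative_def h_def g_def by (blast, blast, blast, simp add: fun_eq_iff add.assoc)
  have g: "smooth (\<lambda>(y, t). g y t)"
    using smooth_add[OF smooth_add[OF smooth_mult[OF smooth_bounded_linear[OF bounded_linear_fst]
        smooth_compose_bounded_linear[OF F2 bounded_linear_snd]]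
        smooth_compose_bounded_linear[OF F3 bounded_linear_snd]] G(1)]
    by (simp add: g_def case_prod_beta')
  have h: "smooth (\<lambda>(y, t). h y t)"
    unfolding h_def by (rule smooth_and_deriv_y_integrand[OF F])
  \<comment> \<open>The summands \<open>y F2\<close> and \<open>F3\<close> disappear after two
    y-derivatives, which leaves \<open>g_yy = h_y\<close>.\<close>
  have "deriv (\<lambda>s. g s t) = (\<lambda>y. F2 t + h y t)" for t
    unfolding g_def by (intro ext DERIV_imp_deriv) (auto intro!: derivative_eq_intros G(2))
  moreover have "deriv (\<lambda>y. F2 t + h y t) y = deriv (\<lambda>y. h y t) y" for y t
    by (intro DERIV_imp_deriv) (auto intro!: derivative_eq_intros smooth_DERIV_y[OF h])
  ultimately have gyy: "(deriv ^^ 2) (\<lambda>s. g s t) y = deriv (\<lambda>s. h s t) y" for y t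
    by (simp add: numeral_eq_Suc)
  have dv: "deriv (\<lambda>s. 6 * c * s * F1 y t + g y t) v = 6 * c * F1 y t" for y t v
    by (intro DERIV_imp_deriv) (auto intro!: derivative_eq_intros)
  \<comment> \<open>Both expressions vanish at every point of the jet space, in particular on jets
    of smooth functions.\<close>
  have "euler_u (multiplier_combination a b c \<Lambda>1 \<Lambda>2) x y t u v = 0" for x y t u v
    unfolding Lambda euler_u_multiplier_combination[OF F g] gyy h_def smooth_and_deriv_y_integrand(2)[OF F]
    by simp
  moreover have "euler_v (multiplier_combination a b c \<Lambda>1 \<Lambda>2) x y t u v = 0" for x y t u v
    unfolding euler_v_multiplier_combination[OF assms(4,5)] unfolding Lambda by (simp add: dv)
  ultimately show "vanishes_identically (euler_u (multiplier_combination a b c \<Lambda>1 \<Lambda>2)) \<and>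
      vanishes_identically (euler_v (multiplier_combination a b c \<Lambda>1 \<Lambda>2))"
    by (simp add: vanishes_identically_def)
qed

end
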